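(* Let $K$ be a field and let $k,d,n$ be integers with $1\leq d\leq n$ and $k\geq 1$. Let $I_{d,n}\subset S=K[x_1,\ldots,x_n]$ be the squarefree Veronese ideal of degree $d$. Then \[ \mathrm{sat}(I_{d,n}^k)=\max\{\,l : (kd-l)/(k-l)\leq n,\ l\leq k\,\}. \]
   Context: $I_{d,n}$ is the ideal of $S=K[x_1,\ldots,x_n]$ generated by all squarefree monomials of degree $d$ in $x_1,\ldots,x_n$. With $\mathfrak{m}=(x_1,\ldots,x_n)$, the saturation number $\mathrm{sat}(J)$ of a graded ideal $J\subset S$ is the smallest integer $t\ge 0$ such that $J:\mathfrak{m}^{t+1}=J:\mathfrak{m}^t$. *)

theory Defs
  imports "HOL-Library.Poly_Mapping" "HOL-Library.Cardinality" "HOL-Library.Extended_Real"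
begin

text \<open>
  The polynomial ring \<open>K[x\<^sub>1, \<dots>, x\<^sub>n]\<close> is the monoid algebra of the exponent vectors over \<open>K\<close>. The
  variables are indexed by a finite type \<open>'n\<close>, so that \<open>n = CARD('n)\<close>.
\<close>

type_synonym ('n, 'k) mpoly = "('n \<Rightarrow>\<^sub>0 nat) \<Rightarrow>\<^sub>0 'k"

definition monomial :: "('n \<Rightarrow>\<^sub>0 nat) \<Rightarrow> ('n, 'k::comm_ring_1) mpoly" where
  "monomial u = Poly_Mapping.single u 1"

definition var :: "'n \<Rightarrow> ('n, 'k::comm_ring_1) mpoly" where
  "var i = monomial (Poly_Mapping.single i 1)"

text \<open>
  Ideals of a commutative ring are the submodules of the ring, viewed as a module over itself.
\<close>

lemma module_mult: "module ((*) :: 'a::comm_ring_1 \<Rightarrow> 'a \<Rightarrow> 'a)"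
  by unfold_locales (simp_all add: algebra_simps)

definition ideal_gen :: "'a::comm_ring_1 set \<Rightarrow> 'a set" where
  "ideal_gen A = module.span (*) A"

definition ideal_prod :: "'a::comm_ring_1 set \<Rightarrow> 'a set \<Rightarrow> 'a set" where
  "ideal_prod I J = ideal_gen {a * b | a b. a \<in> I \<and> b \<in> J}"

primrec ideal_pow :: "'a::comm_ring_1 set \<Rightarrow> nat \<Rightarrow> 'a set" where
  "ideal_pow I 0 = UNIV"
| "ideal_pow I (Suc k) = ideal_prod I (ideal_pow I k)"

definition colon :: "'a::comm_ring_1 set \<Rightarrow> 'a set \<Rightarrow> 'a set" where
  "colon I J = {f. \<forall>g\<in>J. f * g \<in> I}"

definition max_ideal :: "('n, 'k::comm_ring_1) mpoly set" where
  "max_ideal = ideal_gen (range var)"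

definition sat :: "('n, 'k::comm_ring_1) mpoly set \<Rightarrow> nat" where
  "sat J = (LEAST t. colon J (ideal_pow max_ideal (t + 1)) = colon J (ideal_pow max_ideal t))"

definition squarefree_veronese :: "nat \<Rightarrow> ('n::finite, 'k::comm_ring_1) mpoly set" where
  "squarefree_veronese d = ideal_gen
     {monomial u | u. (\<forall>i. Poly_Mapping.lookup u i \<le> 1) \<and> (\<Sum>i\<in>UNIV. Poly_Mapping.lookup u i) = d}"

text \<open>
  The quotient \<open>(kd - l)/(k - l)\<close> is taken in the extended reals. For \<open>l = k\<close> its denominator
  vanishes: then it is \<open>\<infinity>\<close> if \<open>d > 1\<close>, and \<open>0/0 = 0\<close> if \<open>d = 1\<close>, so that \<open>l = k\<close> is
  admitted exactly for \<open>d = 1\<close>, where the ideal is the maximal one and the saturation number of its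
  \<open>k\<close>-th power is \<open>k\<close>. Equivalently, the condition may be read with the denominator cleared:
\<close>

definition veronese_quotient :: "nat \<Rightarrow> nat \<Rightarrow> nat \<Rightarrow> ereal" where
  "veronese_quotient k d l = ereal (real k * real d - real l) / ereal (real k - real l)"

lemma veronese_quotient_le_iff:
  assumes "1 \<le> d" "1 \<le> k" "l \<le> k"
  shows "veronese_quotient k d l \<le> ereal (real n)
    \<longleftrightarrow> real k * real d - real l \<le> real n * (real k - real l)"
proof (cases "l = k")
  case True
  have "real k * real d - real k = real k * (real d - 1)"
    by (simp add: algebra_simps)
  then show ?thesis
    using True assms
    by (cases "d = 1")
       (auto simp: veronese_quotient_def divide_ereal_def mult_le_0_iff zero_ereal_def[symmetric])
next
  case False
  then have "real k - real l > 0"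
    using assms by simp
  then show ?thesis
    by (simp add: veronese_quotient_def pos_divide_le_eq)
qed

end

theory Submission
  imports Defs
begin

text \<open>
  All ideals involved are monomial, hence determined by their sets of exponents. A monomial \<open>x\<^sup>u\<close>
  lies in \<open>I\<^sup>k\<close> iff \<open>\<Sum>\<^sub>i min(u\<^sub>i, k) \<ge> k d\<close>. Multiplying it by a monomial of degree \<open>t\<close> raises this
  sum the least when the degree is concentrated in a single variable, so \<open>x\<^sup>u\<close> lies in \<open>I\<^sup>k : m\<^sup>t\<close> iff
  \<open>\<Sum>\<^sub>i min(u\<^sub>i, k) + min(t, k - min(u\<^sub>j, k)) \<ge> k d\<close> for all \<open>j\<close>. Passing from \<open>t\<close> to \<open>t + 1 = l\<close>
  adds exactly the \<open>u\<close> with \<open>\<Sum>\<^sub>i min(u\<^sub>i, k) = k d - l\<close> and all \<open>min(u\<^sub>i, k) \<le> k - l\<close>; such \<open>u\<close>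
  exist iff \<open>l \<le> k\<close> and \<open>k d - l \<le> n (k - l)\<close>, and this condition is inherited by smaller \<open>l\<close>.
\<close>

section \<open>Monomial ideals and their sets of exponents\<close>

definition monomial_ideal :: "('n \<Rightarrow>\<^sub>0 nat) set \<Rightarrow> ('n, 'k::comm_ring_1) mpoly set" where
  "monomial_ideal U = {f. Poly_Mapping.keys f \<subseteq> U}"

text \<open>Exactly the condition under which \<open>monomial_ideal U\<close> is closed under
  multiplication by arbitrary polynomials.\<close>

definition upclosed :: "('n \<Rightarrow>\<^sub>0 nat) set \<Rightarrow> bool" where
  "upclosed U \<longleftrightarrow> (\<forall>u w. u \<in> U \<longrightarrow> u + w \<in> U)"

lemma monomial_in_monomial_ideal [simp]:
  "(monomial u :: ('n, 'k::comm_ring_1) mpoly) \<in> monomial_ideal U \<longleftrightarrow> u \<in> U"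
  by (simp add: monomial_ideal_def monomial_def)

lemma monomial_ideal_eq_iff:
  "(monomial_ideal U :: ('n, 'k::comm_ring_1) mpoly set) = monomial_ideal V \<longleftrightarrow> U = V"
  by (metis monomial_in_monomial_ideal subsetI subset_antisym)

lemma monomial_mult: "monomial u * monomial v = monomial (u + v)"
  by (simp add: monomial_def mult_single)

lemma poly_mapping_sum_single:
  "f = (\<Sum>v\<in>Poly_Mapping.keys f. Poly_Mapping.single v (Poly_Mapping.lookup f v))"
  by (rule poly_mapping_eqI)
     (auto simp: lookup_sum lookup_single when_def sum.delta' in_keys_iff)

text \<open>Translation of exponents is injective, so no two terms of \<open>f\<close> collide and
  each survives in the product.\<close>

lemma lookup_mult_monomial:
  fixes f :: "('n, 'k::comm_ring_1) mpoly"
  shows "Poly_Mapping.lookup (f * monomial v) (w + v) = Poly_Mapping.lookup f w"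
proof -
  have "f * monomial v = (\<Sum>u\<in>Poly_Mapping.keys f.
      Poly_Mapping.single u (Poly_Mapping.lookup f u) * monomial v)"
    by (subst poly_mapping_sum_single [of f]) (rule sum_distrib_right)
  then show ?thesis
    by (auto simp: monomial_def mult_single lookup_sum lookup_single when_def sum.delta' in_keys_iff)
qed

text \<open>Polynomials supported in an upclosed set form a submodule; conversely, every polynomial
  is the sum of its terms, which are scalar multiples of monomials.\<close>

lemma ideal_gen_eq_monomial_ideal:
  fixes A :: "('n, 'k::comm_ring_1) mpoly set"
  assumes U: "upclosed U" and A: "A \<subseteq> monomial_ideal U"
    and gen: "\<And>u. u \<in> U \<Longrightarrow> monomial u \<in> ideal_gen A"
  shows "ideal_gen A = monomial_ideal U"
proof -
  interpret module "(*) :: ('n, 'k) mpoly \<Rightarrow> _" by (rule module_mult)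
  have "c * f \<in> monomial_ideal U" if "f \<in> monomial_ideal U" for c f :: "('n, 'k) mpoly"
    using keys_mult [of c f] that U
    by (auto simp: monomial_ideal_def upclosed_def subset_iff) (metis add.commute)
  moreover have "f + g \<in> monomial_ideal U"
    if "f \<in> monomial_ideal U" "g \<in> monomial_ideal U" for f g :: "('n, 'k) mpoly"
    using keys_add [of f g] that by (auto simp: monomial_ideal_def)
  ultimately have "subspace (monomial_ideal U)"
    by (auto simp: subspace_def) (simp add: monomial_ideal_def)
  then have "span A \<subseteq> monomial_ideal U"
    by (rule span_minimal [OF A])
  moreover have "f \<in> span A" if f: "f \<in> monomial_ideal U" for f
  proof -
    have "(\<Sum>v\<in>Poly_Mapping.keys f. Poly_Mapping.single v (Poly_Mapping.lookup f v)) \<in> span A"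
    proof (rule span_sum)
      fix v assume "v \<in> Poly_Mapping.keys f"
      then have "monomial v \<in> span A"
        using f gen by (auto simp: monomial_ideal_def ideal_gen_def)
      then have "Poly_Mapping.single 0 (Poly_Mapping.lookup f v) * monomial v \<in> span A"
        by (rule span_scale)
      then show "Poly_Mapping.single v (Poly_Mapping.lookup f v) \<in> span A"
        by (simp add: monomial_def mult_single)
    qed
    then show ?thesis by (simp flip: poly_mapping_sum_single)
  qed
  ultimately show ?thesis by (auto simp: ideal_gen_def)
qed

lemma ideal_gen_base: "a \<in> A \<Longrightarrow> a \<in> ideal_gen A"
  unfolding ideal_gen_def by (rule module.span_base [OF module_mult])

lemma ideal_gen_mult: "a \<in> ideal_gen A \<Longrightarrow> c * a \<in> ideal_gen A"
  unfolding ideal_gen_def by (rule module.span_scale [OF module_mult])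

lemma ideal_gen_monomials:
  assumes "upclosed U" "G \<subseteq> U" and div: "\<And>u. u \<in> U \<Longrightarrow> \<exists>g\<in>G. \<exists>w. u = w + g"
  shows "ideal_gen (monomial ` G) = (monomial_ideal U :: ('n, 'k::comm_ring_1) mpoly set)"
proof (rule ideal_gen_eq_monomial_ideal)
  fix u assume "u \<in> U"
  then obtain g w where "g \<in> G" "u = w + g" using div by blast
  then show "monomial u \<in> ideal_gen (monomial ` G :: ('n, 'k) mpoly set)"
    by (metis monomial_mult ideal_gen_mult ideal_gen_base imageI)
qed (use assms in auto)

text \<open>Together \<open>sub\<close> and \<open>split\<close> make \<open>W\<close> the sumset of
  \<open>U\<close> and \<open>V\<close>; in the applications \<open>split\<close> is the
  combinatorial part.\<close>

lemma ideal_prod_monomial_ideal: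
  assumes W: "upclosed W" and sub: "\<And>u v. u \<in> U \<Longrightarrow> v \<in> V \<Longrightarrow> u + v \<in> W"
    and split: "\<And>w. w \<in> W \<Longrightarrow> \<exists>u\<in>U. \<exists>v\<in>V. w = u + v"
  shows "ideal_prod (monomial_ideal U) (monomial_ideal V)
    = (monomial_ideal W :: ('n, 'k::comm_ring_1) mpoly set)"
  unfolding ideal_prod_def
proof (rule ideal_gen_eq_monomial_ideal)
  show "{a * b |a b. a \<in> monomial_ideal U \<and> b \<in> monomial_ideal V}
      \<subseteq> (monomial_ideal W :: ('n, 'k) mpoly set)"
    using keys_mult sub by (fastforce simp: monomial_ideal_def)
next
  fix w assume "w \<in> W"
  then obtain u v where "u \<in> U" "v \<in> V" "w = u + v" using split by blast
  then show "monomial w \<in> ideal_gen {a * b |a b. a \<in> monomial_ideal U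
      \<and> b \<in> (monomial_ideal V :: ('n, 'k) mpoly set)}"
    by (auto simp flip: monomial_mult intro!: ideal_gen_base)
       (metis monomial_in_monomial_ideal)
qed (rule W)

text \<open>Testing \<open>f\<close> against monomials alone isolates each of its terms, since such
  products have no cancellation.\<close>

lemma colon_monomial_ideal:
  "colon (monomial_ideal U) (monomial_ideal V)
    = (monomial_ideal {u. \<forall>v\<in>V. u + v \<in> U} :: ('n, 'k::comm_ring_1) mpoly set)"
proof (intro subset_antisym subsetI)
  fix f :: "('n, 'k) mpoly"
  assume f: "f \<in> colon (monomial_ideal U) (monomial_ideal V)"
  have "u + v \<in> U" if "u \<in> Poly_Mapping.keys f" "v \<in> V" for u v
  proof -
    have "f * monomial v \<in> monomial_ideal U"
      using f \<open>v \<in> V\<close> by (auto simp: colon_def)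
    moreover have "u + v \<in> Poly_Mapping.keys (f * monomial v)"
      using that by (simp add: in_keys_iff lookup_mult_monomial)
    ultimately show ?thesis by (auto simp: monomial_ideal_def)
  qed
  then show "f \<in> monomial_ideal {u. \<forall>v\<in>V. u + v \<in> U}"
    by (auto simp: monomial_ideal_def)
next
  fix f :: "('n, 'k) mpoly"
  assume f: "f \<in> monomial_ideal {u. \<forall>v\<in>V. u + v \<in> U}"
  show "f \<in> colon (monomial_ideal U) (monomial_ideal V)"
    unfolding colon_def
  proof (intro CollectI ballI)
    fix g :: "('n, 'k) mpoly" assume "g \<in> monomial_ideal V"
    then show "f * g \<in> monomial_ideal U"
      using keys_mult [of f g] f by (fastforce simp: monomial_ideal_def)
  qed
qed

section \<open>Degree and truncated degree of exponents\<close>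

abbreviation exponent :: "('n::finite \<Rightarrow> nat) \<Rightarrow> 'n \<Rightarrow>\<^sub>0 nat" where
  "exponent \<equiv> Poly_Mapping.Abs_poly_mapping"

lemma lookup_exponent [simp]: "Poly_Mapping.lookup (exponent f) = f" for f :: "'n::finite \<Rightarrow> nat"
  by (rule lookup_Abs_poly_mapping) simp

definition deg :: "('n::finite \<Rightarrow>\<^sub>0 nat) \<Rightarrow> nat" where
  "deg u = (\<Sum>i\<in>UNIV. Poly_Mapping.lookup u i)"

text \<open>The largest degree of a divisor whose exponents are all at most \<open>k\<close>, a
  bound that every product of \<open>k\<close> squarefree monomials obeys.\<close>

definition truncated_deg :: "nat \<Rightarrow> ('n::finite \<Rightarrow>\<^sub>0 nat) \<Rightarrow> nat" where
  "truncated_deg k u = (\<Sum>i\<in>UNIV. min (Poly_Mapping.lookup u i) k)"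

lemma deg_add: "deg (u + v) = deg u + deg v"
  by (simp add: deg_def lookup_add sum.distrib)

lemma deg_single [simp]: "deg (Poly_Mapping.single i a) = a"
  by (simp add: deg_def lookup_single when_def sum.delta')

lemma truncated_deg_mono: "truncated_deg k u \<le> truncated_deg k (u + v)"
  unfolding truncated_deg_def by (rule sum_mono) (auto simp: lookup_add)

lemma upclosed_deg_ge: "upclosed {u. t \<le> deg u}"
  by (auto simp: upclosed_def deg_add)

lemma upclosed_truncated_deg_ge: "upclosed {u. t \<le> truncated_deg k u}"
  using truncated_deg_mono by (auto simp: upclosed_def intro: order_trans)

lemma monomial_ideal_UNIV: "monomial_ideal UNIV = UNIV"
  by (simp add: monomial_ideal_def)

section \<open>Powers of the maximal ideal and of the squarefree Veronese ideal\<close>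

lemma split_off_variable:
  assumes "deg u > 0"
  shows "\<exists>i w. u = Poly_Mapping.single i 1 + w"
proof -
  obtain i where i: "Poly_Mapping.lookup u i > 0"
    using assms unfolding deg_def by (metis neq0_conv sum.neutral)
  define w where "w = exponent (\<lambda>j. Poly_Mapping.lookup u j - (if i = j then 1 else 0))"
  have "u = Poly_Mapping.single i 1 + w"
    by (rule poly_mapping_eqI) (use i in \<open>auto simp: w_def lookup_add lookup_single when_def\<close>)
  then show ?thesis by blast
qed

lemma max_ideal_eq:
  "max_ideal = (monomial_ideal {u. 1 \<le> deg u} :: ('n::finite, 'k::comm_ring_1) mpoly set)"
proof -
  have "ideal_gen (monomial ` range (\<lambda>i. Poly_Mapping.single i 1))
      = (monomial_ideal {u. 1 \<le> deg u} :: ('n, 'k) mpoly set)"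
  proof (rule ideal_gen_monomials [OF upclosed_deg_ge])
    fix u :: "'n \<Rightarrow>\<^sub>0 nat" assume "u \<in> {u. 1 \<le> deg u}"
    then show "\<exists>g\<in>range (\<lambda>i. Poly_Mapping.single i 1). \<exists>w. u = w + g"
      using split_off_variable [of u] by (auto simp: add.commute)
  qed auto
  then show ?thesis by (simp add: max_ideal_def var_def image_image)
qed

lemma max_ideal_pow:
  "ideal_pow max_ideal t = (monomial_ideal {u. t \<le> deg u} :: ('n::finite, 'k::comm_ring_1) mpoly set)"
proof (induction t)
  case 0
  show ?case by (simp add: monomial_ideal_UNIV)
next
  case (Suc t)
  show ?case
    unfolding ideal_pow.simps Suc unfolding max_ideal_eq
  proof (rule ideal_prod_monomial_ideal [OF upclosed_deg_ge])
    fix w :: "'n \<Rightarrow>\<^sub>0 nat" assume w: "w \<in> {u. Suc t \<le> deg u}"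
    then obtain i v where "w = Poly_Mapping.single i 1 + v"
      using split_off_variable [of w] by auto
    with w show "\<exists>u\<in>{u. 1 \<le> deg u}. \<exists>v\<in>{u. t \<le> deg u}. w = u + v"
      by (intro bexI [of _ "Poly_Mapping.single i 1"] bexI [of _ v]) (auto simp: deg_add)
  qed (auto simp: deg_add)
qed

text \<open>Coordinates that are at least \<open>Suc k\<close> lose one anyway when the truncation
  level drops to \<open>k\<close>, so subtracting one from them costs nothing more. Hence the
  support of \<open>s\<close> is taken from these coordinates first (\<open>T\<close>), and only
  then from other positive ones (\<open>P\<close>).\<close>

lemma truncated_deg_Suc_split:
  assumes u: "Suc k * d \<le> truncated_deg (Suc k) u"
  shows "\<exists>s w. (\<forall>i. Poly_Mapping.lookup s i \<le> 1) \<and> deg s = d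
    \<and> k * d \<le> truncated_deg k w \<and> u = s + w"
proof -
  let ?u = "Poly_Mapping.lookup u"
  define T where "T = {i. Suc k \<le> ?u i}"
  define P where "P = {i. 0 < ?u i}"
  have TP: "T \<subseteq> P" by (auto simp: T_def P_def)
  have "\<exists>A. A \<subseteq> P \<and> card A = d \<and> k * d \<le> (\<Sum>i\<in>UNIV. min (?u i - of_bool (i \<in> A)) k)"
  proof (cases "d \<le> card T")
    case True
    then obtain A where A: "A \<subseteq> T" "card A = d"
      using obtain_subset_with_card_n by metis
    \<comment> \<open>Coordinates in \<open>T\<close> remain at least \<open>k\<close> after losing
      one, so \<open>T\<close> alone reaches the bound.\<close>
    have "k * d \<le> (\<Sum>i\<in>T. k)" using True by simp
    also have "\<dots> \<le> (\<Sum>i\<in>T. min (?u i - of_bool (i \<in> A)) k)"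
      by (rule sum_mono) (auto simp: T_def)
    also have "\<dots> \<le> (\<Sum>i\<in>UNIV. min (?u i - of_bool (i \<in> A)) k)"
      by (rule sum_mono2) auto
    finally show ?thesis using A TP by blast
  next
    case False
    have "Suc k * d \<le> (\<Sum>i\<in>UNIV. min (?u i) (Suc k))"
      using u by (simp add: truncated_deg_def)
    also have "\<dots> = (\<Sum>i\<in>P. min (?u i) (Suc k))"
      by (rule sum.mono_neutral_right) (auto simp: P_def)
    also have "\<dots> \<le> (\<Sum>i\<in>P. Suc k)"
      by (rule sum_mono) simp
    also have "\<dots> = Suc k * card P" by simp
    finally have "d \<le> card P" by (simp only: mult_le_cancel1)
    then obtain A where A: "T \<subseteq> A" "A \<subseteq> P" "card A = d"
      using exists_subset_between [of T d P] False TP by auto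
    \<comment> \<open>On \<open>A\<close> the coordinate is positive and drops by one; outside
      \<open>A\<close>, hence outside \<open>T\<close>, it is at most \<open>k\<close> and both
      truncations agree. So the total drops by exactly \<open>d\<close>.\<close>
    have "min (?u i - of_bool (i \<in> A)) k + of_bool (i \<in> A) = min (?u i) (Suc k)" for i
      using A(1,2) by (auto simp: T_def P_def subset_iff min_def)
    then have "(\<Sum>i\<in>UNIV. min (?u i - of_bool (i \<in> A)) k) + (\<Sum>i\<in>UNIV. of_bool (i \<in> A))
        = truncated_deg (Suc k) u"
      unfolding truncated_deg_def sum.distrib [symmetric] by simp
    then have "k * d \<le> (\<Sum>i\<in>UNIV. min (?u i - of_bool (i \<in> A)) k)"
      using u A(3) by simp
    with A show ?thesis by blast
  qed
  then obtain A where A: "A \<subseteq> P" "card A = d"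
    "k * d \<le> (\<Sum>i\<in>UNIV. min (?u i - of_bool (i \<in> A)) k)" by blast
  define s where "s = exponent (\<lambda>i. of_bool (i \<in> A))"
  define w where "w = exponent (\<lambda>i. ?u i - of_bool (i \<in> A))"
  have "u = s + w"
    by (rule poly_mapping_eqI) (use A(1) in \<open>auto simp: s_def w_def lookup_add P_def\<close>)
  then show ?thesis
    using A by (intro exI [of _ s] exI [of _ w]) (auto simp: s_def w_def deg_def truncated_deg_def)
qed

lemma squarefree_veronese_eq:
  "squarefree_veronese d
    = (monomial_ideal {u. d \<le> truncated_deg 1 u} :: ('n::finite, 'k::comm_ring_1) mpoly set)"
proof -
  let ?G = "{u :: 'n \<Rightarrow>\<^sub>0 nat. (\<forall>i. Poly_Mapping.lookup u i \<le> 1) \<and> deg u = d}"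
  have "ideal_gen (monomial ` ?G)
      = (monomial_ideal {u. d \<le> truncated_deg 1 u} :: ('n, 'k) mpoly set)"
  proof (rule ideal_gen_monomials [OF upclosed_truncated_deg_ge])
    show "?G \<subseteq> {u. d \<le> truncated_deg 1 u}"
      by (auto simp: deg_def truncated_deg_def min_def)
  next
    fix u :: "'n \<Rightarrow>\<^sub>0 nat" assume "u \<in> {u. d \<le> truncated_deg 1 u}"
    \<comment> \<open>At level \<open>0\<close> the bound on the cofactor is vacuous, and the
      splitting just yields a squarefree divisor of degree \<open>d\<close>.\<close>
    then show "\<exists>g\<in>?G. \<exists>w. u = w + g"
      using truncated_deg_Suc_split [of 0 d u] by (fastforce simp: add.commute)
  qed
  moreover have "monomial ` ?G = {monomial u :: ('n, 'k) mpoly | u. (\<forall>i. Poly_Mapping.lookup u i \<le> 1)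
      \<and> (\<Sum>i\<in>UNIV. Poly_Mapping.lookup u i) = d}"
    by (auto simp: deg_def)
  ultimately show ?thesis by (simp add: squarefree_veronese_def)
qed

lemma squarefree_veronese_pow:
  "ideal_pow (squarefree_veronese d) k
    = (monomial_ideal {u. k * d \<le> truncated_deg k u} :: ('n::finite, 'k::comm_ring_1) mpoly set)"
proof (induction k)
  case 0
  show ?case by (simp add: monomial_ideal_UNIV)
next
  case (Suc k)
  show ?case
    unfolding ideal_pow.simps Suc unfolding squarefree_veronese_eq
  proof (rule ideal_prod_monomial_ideal [OF upclosed_truncated_deg_ge])
    fix u v :: "'n \<Rightarrow>\<^sub>0 nat"
    have "truncated_deg 1 u + truncated_deg k v \<le> truncated_deg (Suc k) (u + v)"
      unfolding truncated_deg_def sum.distrib [symmetric]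
      by (rule sum_mono) (auto simp: lookup_add)
    moreover assume "u \<in> {u. d \<le> truncated_deg 1 u}" "v \<in> {u. k * d \<le> truncated_deg k u}"
    ultimately show "u + v \<in> {u. Suc k * d \<le> truncated_deg (Suc k) u}" by simp
  next
    fix w :: "'n \<Rightarrow>\<^sub>0 nat" assume "w \<in> {u. Suc k * d \<le> truncated_deg (Suc k) u}"
    then obtain s v where sv: "\<forall>i. Poly_Mapping.lookup s i \<le> 1" "deg s = d"
      "k * d \<le> truncated_deg k v" "w = s + v"
      using truncated_deg_Suc_split [of k d w] by auto
    then have "d \<le> truncated_deg 1 s"
      by (auto simp: deg_def truncated_deg_def min_def)
    with sv show "\<exists>u\<in>{u. d \<le> truncated_deg 1 u}. \<exists>v\<in>{u. k * d \<le> truncated_deg k u}. w = u + v"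
      by blast
  qed
qed

section \<open>Colon ideals by powers of the maximal ideal\<close>

lemma truncated_deg_add_ge_iff:
  fixes u :: "'n::finite \<Rightarrow>\<^sub>0 nat"
  shows "(\<forall>v. t \<le> deg v \<longrightarrow> m \<le> truncated_deg k (u + v))
    \<longleftrightarrow> (\<forall>j. m \<le> truncated_deg k u + min t (k - min (Poly_Mapping.lookup u j) k))"
  (is "?L \<longleftrightarrow> ?R")
proof
  assume ?L
  show ?R
  proof
    fix j
    \<comment> \<open>The test vector puts the whole degree \<open>t\<close> on variable
      \<open>j\<close>; its gain is cut off at the room left below \<open>k\<close>.\<close>
    have "min (Poly_Mapping.lookup (u + Poly_Mapping.single j t) i) k = min (Poly_Mapping.lookup u i) k
        + (if i = j then min t (k - min (Poly_Mapping.lookup u j) k) else 0)" for i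
      by (auto simp: lookup_add lookup_single when_def)
    then have "truncated_deg k (u + Poly_Mapping.single j t)
        = truncated_deg k u + min t (k - min (Poly_Mapping.lookup u j) k)"
      by (simp add: truncated_deg_def sum.distrib)
    then show "m \<le> truncated_deg k u + min t (k - min (Poly_Mapping.lookup u j) k)"
      using \<open>?L\<close> by (metis deg_single order_refl)
  qed
next
  assume R: ?R
  show ?L
  proof (intro allI impI)
    fix v :: "'n \<Rightarrow>\<^sub>0 nat" assume v: "t \<le> deg v"
    let ?gain = "\<lambda>i. min (Poly_Mapping.lookup v i) (k - min (Poly_Mapping.lookup u i) k)"
    have "min (Poly_Mapping.lookup (u + v) i) k = min (Poly_Mapping.lookup u i) k + ?gain i" for i
      by (auto simp: lookup_add)
    then have eq: "truncated_deg k (u + v) = truncated_deg k u + (\<Sum>i\<in>UNIV. ?gain i)"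
      by (simp add: truncated_deg_def sum.distrib)
    have "\<exists>j. min t (k - min (Poly_Mapping.lookup u j) k) \<le> (\<Sum>i\<in>UNIV. ?gain i)"
    \<comment> \<open>Either \<open>v\<close> fills up some coordinate \<open>j\<close>, whose gain
      is then all its room, or nothing is cut off and the total gain is \<open>deg v\<close>, so any
      \<open>j\<close> will do.\<close>
    proof (cases "\<exists>j. k - min (Poly_Mapping.lookup u j) k \<le> Poly_Mapping.lookup v j")
      case True
      then obtain j where "k - min (Poly_Mapping.lookup u j) k \<le> Poly_Mapping.lookup v j" ..
      moreover have "?gain j \<le> (\<Sum>i\<in>UNIV. ?gain i)"
        by (rule member_le_sum) auto
      ultimately show ?thesis by (intro exI [of _ j]) (simp add: min_def split: if_splits)
    next
      case False
      then have "(\<Sum>i\<in>UNIV. ?gain i) = deg v"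
        unfolding deg_def by (intro sum.cong) (auto simp: not_le intro!: min_absorb1)
      then show ?thesis using v by auto
    qed
    then show "m \<le> truncated_deg k (u + v)"
      using R unfolding eq by (meson add_left_mono order_trans)
  qed
qed

lemma colon_squarefree_veronese_pow:
  "colon (ideal_pow (squarefree_veronese d) k) (ideal_pow max_ideal t)
    = (monomial_ideal {u. \<forall>j. k * d \<le> truncated_deg k u + min t (k - min (Poly_Mapping.lookup u j) k)}
        :: ('n::finite, 'k::comm_ring_1) mpoly set)"
  by (simp add: squarefree_veronese_pow max_ideal_pow colon_monomial_ideal truncated_deg_add_ge_iff)

section \<open>Where the chain of colon ideals grows\<close>

lemma exists_bounded_sum_eq:
  assumes "finite A" "m \<le> card A * b"
  shows "\<exists>f :: 'a \<Rightarrow> nat. (\<forall>i. f i \<le> b) \<and> sum f A = m"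
  using assms
proof (induction A arbitrary: m)
  case empty
  then show ?case by (intro exI [of _ "\<lambda>_. 0"]) auto
next
  case (insert a A)
  \<comment> \<open>Greedy filling: \<open>a\<close> takes as much of \<open>m\<close> as the bound
    \<open>b\<close> allows.\<close>
  have "m - min m b \<le> card A * b" using insert by auto
  then obtain f where f: "\<forall>i. f i \<le> b" "sum f A = m - min m b"
    using insert.IH by blast
  have "sum (f(a := min m b)) A = sum f A"
    using insert.hyps by (intro sum.cong) auto
  then show ?case
    using f insert.hyps by (intro exI [of _ "f(a := min m b)"]) auto
qed

lemma colon_step_neq_iff:
  fixes k d t :: nat
  assumes "1 \<le> d"
  shows "colon (ideal_pow (squarefree_veronese d :: ('n::finite, 'k::comm_ring_1) mpoly set) k)
        (ideal_pow max_ideal (t + 1))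
      \<noteq> colon (ideal_pow (squarefree_veronese d) k) (ideal_pow max_ideal t)
    \<longleftrightarrow> t + 1 \<le> k \<and> k * d - (t + 1) \<le> CARD('n) * (k - (t + 1))"
    (is "?neq \<longleftrightarrow> ?cond")
proof -
  define C where "C t = {u :: 'n \<Rightarrow>\<^sub>0 nat.
    \<forall>j. k * d \<le> truncated_deg k u + min t (k - min (Poly_Mapping.lookup u j) k)}" for t
  have neq: "?neq \<longleftrightarrow> C (t + 1) \<noteq> C t"
    by (simp only: colon_squarefree_veronese_pow monomial_ideal_eq_iff C_def)
  \<comment> \<open>The chain increases with \<open>t\<close>, so a difference between neighbours
    gives an exponent in the larger set only.\<close>
  have sub: "C t \<subseteq> C (t + 1)"
    unfolding C_def by (intro Collect_mono all_mono impI, erule order_trans)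
      (auto intro: add_left_mono)
  show ?thesis
  proof
    assume ?neq
    then obtain u where "u \<in> C (t + 1)" "u \<notin> C t" using neq sub by blast
    then obtain j where u: "\<And>i. k * d \<le> truncated_deg k u
          + min (t + 1) (k - min (Poly_Mapping.lookup u i) k)"
      and j: "truncated_deg k u + min t (k - min (Poly_Mapping.lookup u j) k) < k * d"
      by (auto simp: C_def not_le)
    \<comment> \<open>The gain at \<open>j\<close> falls short at \<open>t\<close>, suffices at
      \<open>t + 1\<close>, and grows by at most one in between. So the deficit is exactly
      \<open>t + 1\<close>, and the room at \<open>j\<close> is at least that; the same deficit then
      bounds the room at every \<open>i\<close>.\<close>
    have deg: "truncated_deg k u + (t + 1) = k * d"
      and le: "t + 1 \<le> k - min (Poly_Mapping.lookup u j) k"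
      using u [of j] j by (auto simp: min_def split: if_splits)
    have "min (Poly_Mapping.lookup u i) k \<le> k - (t + 1)" for i
      using u [of i] deg by (auto simp: min_def split: if_splits)
    then have "truncated_deg k u \<le> (\<Sum>i\<in>(UNIV :: 'n set). k - (t + 1))"
      unfolding truncated_deg_def by (intro sum_mono)
    then show ?cond using deg le by auto
  next
    assume cond: ?cond
    then obtain f :: "'n \<Rightarrow> nat" where f: "\<And>i. f i \<le> k - (t + 1)" "sum f UNIV = k * d - (t + 1)"
      using exists_bounded_sum_eq [of "UNIV :: 'n set" "k * d - (t + 1)" "k - (t + 1)"] by auto
    have min_f: "min (f i) k = f i" for i
      using f(1) [of i] by simp
    have "truncated_deg k (exponent f) = k * d - (t + 1)"
      using f(2) by (simp add: truncated_deg_def min_f)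
    \<comment> \<open>With \<open>t + 1 \<le> k\<close>, this makes the natural subtraction in the
      degree of \<open>f\<close> exact.\<close>
    moreover have "k \<le> k * d" using assms by simp
    ultimately have deg: "truncated_deg k (exponent f) + (t + 1) = k * d"
      using cond by linarith
    have le: "t + 1 \<le> k - f i" for i
      using f(1) [of i] cond by linarith
    have "min (t + 1) (k - f i) = t + 1" "min t (k - f i) = t" for i
      using le [of i] by auto
    then have "exponent f \<in> C (t + 1)" "exponent f \<notin> C t"
      using deg by (simp_all add: C_def min_f)
    then show ?neq using neq by blast
  qed
qed

text \<open>The set of \<open>l\<close> with \<open>P l\<close> is a finite initial segment, so the
  first index whose successor leaves it is its maximum. This turns the \<open>LEAST\<close> in
  \<open>sat\<close> into a \<open>Max\<close>.\<close>

lemma Least_not_Suc_eq_Max: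
  fixes P :: "nat \<Rightarrow> bool"
  assumes "P 0" and bounded: "\<And>l. P l \<Longrightarrow> l \<le> k"
    and down: "\<And>l. P (Suc l) \<Longrightarrow> P l"
  shows "(LEAST t. \<not> P (Suc t)) = Max {l. P l}"
proof -
  have fin: "finite {l. P l}" by (rule finite_subset [of _ "{..k}"]) (auto dest: bounded)
  have anti: "P m" if "m \<le> l" "P l" for l m
    using that by (induction rule: dec_induct) (auto dest: down)
  have "P (Max {l. P l})" using Max_in [OF fin] \<open>P 0\<close> by auto
  moreover have "\<not> P (Suc (Max {l. P l}))"
    using Max_ge [OF fin, of "Suc (Max {l. P l})"] by auto
  ultimately show ?thesis
    by (intro Least_equality) (assumption, meson anti not_less_eq_eq)
qed

theorem corollary2p7:
  fixes k d n :: nat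
  assumes "n = CARD('n::finite)" and "1 \<le> d" and "d \<le> n" and "1 \<le> k"
  shows "sat (ideal_pow (squarefree_veronese d :: ('n::finite, 'k::field) mpoly set) k)
    = Max {l :: nat. veronese_quotient k d l \<le> ereal (real n) \<and> l \<le> k}"
proof -
  define P where "P l \<longleftrightarrow> l \<le> k \<and> k * d - l \<le> n * (k - l)" for l
  have P_iff: "veronese_quotient k d l \<le> ereal (real n) \<and> l \<le> k \<longleftrightarrow> P l" for l
  proof (cases "l \<le> k")
    case True
    \<comment> \<open>Ensures that the natural difference \<open>k * d - l\<close> agrees with the
      real one.\<close>
    have "l \<le> k * d" using True assms(2) by (metis le_trans mult_le_mono2 nat_mult_1_right)
    then have "real k * real d - real l \<le> real n * (real k - real l)
        \<longleftrightarrow> real (k * d - l) \<le> real (n * (k - l))"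
      using True by (simp add: of_nat_diff)
    also have "\<dots> \<longleftrightarrow> k * d - l \<le> n * (k - l)" by (rule of_nat_le_iff)
    finally show ?thesis
      using veronese_quotient_le_iff [OF assms(2,4) True] True by (simp add: P_def)
  qed (simp add: P_def)
  let ?J = "ideal_pow (squarefree_veronese d :: ('n, 'k) mpoly set) k"
  have "colon ?J (ideal_pow max_ideal (t + 1)) = colon ?J (ideal_pow max_ideal t)
      \<longleftrightarrow> \<not> P (Suc t)" for t
    using colon_step_neq_iff [OF assms(2), where k = k and t = t and 'n = 'n and 'k = 'k]
    unfolding P_def assms(1) Suc_eq_plus1 by argo
  then have "sat ?J = (LEAST t. \<not> P (Suc t))"
    by (simp only: sat_def)
  also have "\<dots> = Max {l. P l}"
  proof (rule Least_not_Suc_eq_Max [where k = k])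
    show "P 0" using assms(3) by (simp add: P_def mult.commute)
  next
    fix l assume P: "P (Suc l)"
    \<comment> \<open>Passing from \<open>Suc l\<close> to \<open>l\<close> raises the right side by
      \<open>n \<ge> 1\<close> and the left side by at most one.\<close>
    then have "n * (k - l) = n + n * (k - Suc l)" by (simp add: P_def flip: Suc_diff_Suc)
    moreover have "1 \<le> n" using assms(2,3) by simp
    ultimately show "P l" using P unfolding P_def by linarith
  qed (simp add: P_def)
  finally show ?thesis by (simp only: P_iff)
qed

end
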